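(* Let $1\le\ell\le u$ be integers and $\theta=\frac{u}{\ell}$. The maximum gap for the uniform model satisfies $$\max_{I}\frac{\mathrm{OPT}(I)}{\mathrm{WST}(I)}=\theta,$$ where the maximum is over all instances $I$ of HRT-MSLQ in which every hospital has lower quota $\ell$ and upper quota $u$. Moreover, this equality holds even if the maximum is restricted to such instances in which preference lists of hospitals contain no ties.
   Context: An instance $I$ of HRT-MSLQ consists of a set $R=\{r_1,\dots,r_n\}$ of residents ($n\ge 1$) and a set $H=\{h_1,\dots,h_m\}$ of hospitals. Each resident $r$ has a complete preference list over $H$ that may contain ties (a total preorder $\succeq_r$; $\succ_r$ is strict preference), and each hospital likewise has a complete preference list over $R$ that may contain ties. Each hospital $h$ has an integer lower quota $\ell(h)$ and upper quota $u(h)$ with $0\le \ell(h)\le u(h)\le n$, $u(h)\ge 1$. Standing assumption: $|R|<\sum_{h\in H}u(h)$. An assignment is a set $M\subseteq R\times H$; $M(r)=\{h:(r,h)\in M\}$, $M(h)=\{r:(r,h)\in M\}$. $M$ is a matching if $|M(r)|\le 1$ for all $r$ and $|M(h)|\le u(h)$ for all $h$; then $M(r)$ also denotes the unique hospital of a matched resident $r$. A pair $(r,h)$ blocks a matching $M$ if (i) $r$ is unmatched in $M$ or $h\succ_r M(r)$, and (ii) $|M(h)|<u(h)$ or $h$ strictly prefers $r$ to at least one resident in $M(h)$. $M$ is stable if no pair blocks it. The score of $h$ in $M$ is $s_M(h)=\min\{1,|M(h)|/\ell(h)\}$, with $s_M(h)=1$ if $\ell(h)=0$; the score of $M$ is $s(M)=\sum_{h\in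 H}s_M(h)$. $\mathrm{OPT}(I)$ and $\mathrm{WST}(I)$ are respectively the maximum and minimum of $s(M)$ over all stable matchings $M$ of $I$. *)

theory Defs
  imports Complex_Main
begin

text \<open>
  A pair \<open>(x, y)\<close> in a preference relation means that \<open>x\<close> is weakly preferred to \<open>y\<close>;
  \<open>x\<close> and \<open>y\<close> are tied if \<open>(y, x)\<close> is in the relation as well.
\<close>

record ('r, 'h) hrt_mslq =
  residents :: "'r set"
  hospitals :: "'h set"
  res_pref :: "'r \<Rightarrow> 'h rel"
  hosp_pref :: "'h \<Rightarrow> 'r rel"
  lower_quota :: "'h \<Rightarrow> nat"
  upper_quota :: "'h \<Rightarrow> nat"

definition total_preorder_on :: "'a set \<Rightarrow> 'a rel \<Rightarrow> bool" where
  "total_preorder_on A p \<longleftrightarrow> preorder_on A p \<and> total_on A p"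

definition strictly_prefers :: "'a rel \<Rightarrow> 'a \<Rightarrow> 'a \<Rightarrow> bool" where
  "strictly_prefers p x y \<longleftrightarrow> (x, y) \<in> p \<and> (y, x) \<notin> p"

definition hrt_mslq_instance :: "('r, 'h) hrt_mslq \<Rightarrow> bool" where
  "hrt_mslq_instance I \<longleftrightarrow>
     finite (residents I) \<and> residents I \<noteq> {} \<and> finite (hospitals I) \<and>
     (\<forall>r\<in>residents I. total_preorder_on (hospitals I) (res_pref I r)) \<and>
     (\<forall>h\<in>hospitals I. total_preorder_on (residents I) (hosp_pref I h)) \<and>
     (\<forall>h\<in>hospitals I. lower_quota I h \<le> upper_quota I h \<and>
        upper_quota I h \<le> card (residents I) \<and> 1 \<le> upper_quota I h) \<and>
     card (residents I) < (\<Sum>h\<in>hospitals I. upper_quota I h)"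

definition uniform_quotas :: "nat \<Rightarrow> nat \<Rightarrow> ('r, 'h) hrt_mslq \<Rightarrow> bool" where
  "uniform_quotas l u I \<longleftrightarrow>
     (\<forall>h\<in>hospitals I. lower_quota I h = l \<and> upper_quota I h = u)"

definition hospitals_no_ties :: "('r, 'h) hrt_mslq \<Rightarrow> bool" where
  "hospitals_no_ties I \<longleftrightarrow> (\<forall>h\<in>hospitals I. antisym (hosp_pref I h))"

definition hospitals_of :: "('r \<times> 'h) set \<Rightarrow> 'r \<Rightarrow> 'h set" where
  "hospitals_of M r = {h. (r, h) \<in> M}"

definition residents_of :: "('r \<times> 'h) set \<Rightarrow> 'h \<Rightarrow> 'r set" where
  "residents_of M h = {r. (r, h) \<in> M}"

definition is_matching :: "('r, 'h) hrt_mslq \<Rightarrow> ('r \<times> 'h) set \<Rightarrow> bool" where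
  "is_matching I M \<longleftrightarrow>
     M \<subseteq> residents I \<times> hospitals I \<and>
     (\<forall>r\<in>residents I. card (hospitals_of M r) \<le> 1) \<and>
     (\<forall>h\<in>hospitals I. card (residents_of M h) \<le> upper_quota I h)"

text \<open>
  For a matching, \<open>hospitals_of M r\<close> is empty or a singleton, so the existential over it
  compares \<open>h\<close> with the unique hospital of a matched resident \<open>r\<close>.
\<close>

definition blocks :: "('r, 'h) hrt_mslq \<Rightarrow> ('r \<times> 'h) set \<Rightarrow> 'r \<Rightarrow> 'h \<Rightarrow> bool" where
  "blocks I M r h \<longleftrightarrow>
     (hospitals_of M r = {} \<or>
      (\<exists>h'\<in>hospitals_of M r. strictly_prefers (res_pref I r) h h')) \<and>
     (card (residents_of M h) < upper_quota I h \<or>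
      (\<exists>r'\<in>residents_of M h. strictly_prefers (hosp_pref I h) r r'))"

definition is_stable :: "('r, 'h) hrt_mslq \<Rightarrow> ('r \<times> 'h) set \<Rightarrow> bool" where
  "is_stable I M \<longleftrightarrow>
     is_matching I M \<and> (\<forall>r\<in>residents I. \<forall>h\<in>hospitals I. \<not> blocks I M r h)"

definition hospital_score :: "('r, 'h) hrt_mslq \<Rightarrow> ('r \<times> 'h) set \<Rightarrow> 'h \<Rightarrow> real" where
  "hospital_score I M h =
     (if lower_quota I h = 0 then 1
      else min 1 (real (card (residents_of M h)) / real (lower_quota I h)))"

definition score :: "('r, 'h) hrt_mslq \<Rightarrow> ('r \<times> 'h) set \<Rightarrow> real" where
  "score I M = (\<Sum>h\<in>hospitals I. hospital_score I M h)"

definition OPT :: "('r, 'h) hrt_mslq \<Rightarrow> real" where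
  "OPT I = Max (score I ` {M. is_stable I M})"

definition WST :: "('r, 'h) hrt_mslq \<Rightarrow> real" where
  "WST I = Min (score I ` {M. is_stable I M})"

definition is_maximum_of :: "'a::order \<Rightarrow> 'a set \<Rightarrow> bool" where
  "is_maximum_of x S \<longleftrightarrow> x \<in> S \<and> (\<forall>y\<in>S. y \<le> x)"

end

theory Submission
  imports Defs
begin

text \<open>
  In a stable matching every resident is matched, because the total capacity exceeds the number
  \<open>n\<close> of residents. A hospital with \<open>k \<le> u\<close> residents scores between \<open>k / u\<close> and \<open>k / l\<close>, so
  every stable score lies between \<open>n / u\<close> and \<open>n / l\<close>. When the residents are
  indifferent between all hospitals, every complete matching is stable; with \<open>l * u\<close> residents one
  can fill either \<open>l\<close> hospitals with \<open>u\<close> residents each or \<open>u\<close> hospitals with \<open>l\<close> each.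

  Stable matchings exist by an extremal argument in the style of Sotomayor: among the matchings
  blocked only by pairs with an unmatched resident, take one that is best for the hospitals.
\<close>

section \<open>Numerical ranks for preference lists\<close>

text \<open>Better elements get larger ranks, so the extremal choices below reduce to maximising a
  natural number.\<close>

definition pref_rank :: "'a set \<Rightarrow> 'a rel \<Rightarrow> 'a \<Rightarrow> nat" where
  "pref_rank A p x = card {y \<in> A. strictly_prefers p x y}"

lemma strictly_prefers_trans:
  assumes "trans p" "strictly_prefers p x y" "strictly_prefers p y z"
  shows "strictly_prefers p x z"
  using assms unfolding strictly_prefers_def by (meson transD)

text \<open>By transitivity everything worse than \<open>y\<close> is worse than \<open>x\<close>;
  the inclusion is proper because \<open>y\<close> itself is counted for \<open>x\<close>
  only.\<close>

lemma pref_rank_less: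
  assumes "finite A" "trans p" "y \<in> A" "strictly_prefers p x y"
  shows "pref_rank A p y < pref_rank A p x"
  unfolding pref_rank_def
proof (rule psubset_card_mono)
  have "\<not> strictly_prefers p y y"
    by (simp add: strictly_prefers_def)
  then show "{z \<in> A. strictly_prefers p y z} \<subset> {z \<in> A. strictly_prefers p x z}"
    using assms(3,4) strictly_prefers_trans[OF assms(2,4)] by blast
qed (use assms in simp)

lemma finite_arg_max:
  fixes f :: "'a \<Rightarrow> nat"
  assumes "finite A" "A \<noteq> {}"
  shows "\<exists>a\<in>A. \<forall>b\<in>A. f b \<le> f a"
proof -
  have "Max (f ` A) \<in> f ` A"
    using assms by simp
  then obtain a where "a \<in> A" "f a = Max (f ` A)"
    by force
  then show ?thesis
    using assms by (intro bexI[of _ a]) simp_all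
qed

lemma trans_res_pref:
  "hrt_mslq_instance I \<Longrightarrow> r \<in> residents I \<Longrightarrow> trans (res_pref I r)"
  by (simp add: hrt_mslq_instance_def total_preorder_on_def preorder_on_def)

lemma trans_hosp_pref:
  "hrt_mslq_instance I \<Longrightarrow> h \<in> hospitals I \<Longrightarrow> trans (hosp_pref I h)"
  by (simp add: hrt_mslq_instance_def total_preorder_on_def preorder_on_def)

section \<open>Adding and removing a single pair\<close>

lemma residents_of_insert:
  "residents_of (insert (r, h) M) h' =
     (if h' = h then insert r (residents_of M h') else residents_of M h')"
  by (auto simp: residents_of_def)

lemma hospitals_of_insert:
  "hospitals_of (insert (r, h) M) r' =
     (if r' = r then insert h (hospitals_of M r') else hospitals_of M r')"
  by (auto simp: hospitals_of_def)

lemma residents_of_remove: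
  "residents_of (M - {(r, h)}) h' =
     (if h' = h then residents_of M h' - {r} else residents_of M h')"
  by (auto simp: residents_of_def)

lemma hospitals_of_remove:
  "hospitals_of (M - {(r, h)}) r' =
     (if r' = r then hospitals_of M r' - {h} else hospitals_of M r')"
  by (auto simp: hospitals_of_def)

lemma finite_residents_of: "finite M \<Longrightarrow> finite (residents_of M h)"
  by (rule finite_subset[of _ "fst ` M"]) (force simp: residents_of_def)+

lemma finite_hospitals_of: "finite M \<Longrightarrow> finite (hospitals_of M r)"
  by (rule finite_subset[of _ "snd ` M"]) (force simp: hospitals_of_def)+

lemma finite_matching:
  assumes "hrt_mslq_instance I" "is_matching I M"
  shows "finite M"
  using assms unfolding hrt_mslq_instance_def is_matching_def
  by (meson finite_SigmaI finite_subset)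

section \<open>Existence of stable matchings\<close>

text \<open>A relaxation of stability that the empty matching satisfies, so there is always a
  candidate to maximise over.\<close>

definition simple_matching :: "('r, 'h) hrt_mslq \<Rightarrow> ('r \<times> 'h) set \<Rightarrow> bool" where
  "simple_matching I M \<longleftrightarrow> is_matching I M \<and>
     (\<forall>r\<in>residents I. \<forall>h\<in>hospitals I. blocks I M r h \<longrightarrow> hospitals_of M r = {})"

text \<open>The \<open>Suc\<close> makes every pair count at least 1, so that filling a vacancy
  raises the welfare even with a resident of rank 0.\<close>

definition hospital_welfare :: "('r, 'h) hrt_mslq \<Rightarrow> ('r \<times> 'h) set \<Rightarrow> nat" where
  "hospital_welfare I M = (\<Sum>(r, h)\<in>M. Suc (pref_rank (residents I) (hosp_pref I h) r))"

text \<open>The improvement step: an unmatched \<open>r\<close> takes its best blocking hospital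
  \<open>h\<close>. Here \<open>N\<close> is \<open>M\<close> after a seat at \<open>h\<close> is
  secured, either a vacant one or that of a less preferred \<open>r'\<close>. The displaced
  \<open>r'\<close> becomes unmatched and may therefore block, while \<open>h\<close> is now harder
  to block with than before.\<close>

lemma simple_matching_satisfy:
  assumes I: "hrt_mslq_instance I" and M: "simple_matching I M"
    and r: "r \<in> residents I" "hospitals_of M r = {}"
    and h: "h \<in> hospitals I"
    and best: "\<And>h'. h' \<in> hospitals I \<Longrightarrow> blocks I M r h' \<Longrightarrow>
                  \<not> strictly_prefers (res_pref I r) h' h"
    and N: "N = M \<and> card (residents_of M h) < upper_quota I h \<or>
            N = M - {(r', h)} \<and> (r', h) \<in> M \<and> strictly_prefers (hosp_pref I h) r r'"
  shows "simple_matching I (insert (r, h) N)"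
proof -
  have match: "is_matching I M"
    using M by (simp add: simple_matching_def)
  have finM: "finite M"
    using finite_matching[OF I match] .
  have r_notin: "r \<notin> residents_of M h'" for h'
    using r by (auto simp: residents_of_def hospitals_of_def)
  have hr: "hospitals_of N r = {}"
    using N r by (auto simp: hospitals_of_def)
  have other: "residents_of (insert (r, h) N) h' = residents_of M h'" if "h' \<noteq> h" for h'
    using N that by (auto simp: residents_of_insert residents_of_remove)
  have card_h: "card (residents_of (insert (r, h) N) h) \<le> upper_quota I h \<and>
      card (residents_of M h) \<le> card (residents_of (insert (r, h) N) h)"
    using N
  proof
    assume "N = M \<and> card (residents_of M h) < upper_quota I h"
    then show ?thesis
      using r_notin finite_residents_of[OF finM] by (simp add: residents_of_insert)
  next
    assume *: "N = M - {(r', h)} \<and> (r', h) \<in> M \<and> strictly_prefers (hosp_pref I h) r r'"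
    then have r': "r' \<in> residents_of M h"
      by (simp add: residents_of_def)
    have fin: "finite (residents_of M h)"
      using finite_residents_of[OF finM] .
    have "card (residents_of (insert (r, h) N) h) = Suc (card (residents_of M h - {r'}))"
      using * r_notin fin by (simp add: residents_of_insert residents_of_remove)
    also have "\<dots> = card (residents_of M h)"
      using card_Suc_Diff1[OF fin r'] .
    finally show ?thesis
      using match h by (simp add: is_matching_def)
  qed
  have sub: "hospitals_of N x \<subseteq> hospitals_of M x" for x
    using N by (auto simp: hospitals_of_def)
  have "card (hospitals_of (insert (r, h) N) x) \<le> 1" if "x \<in> residents I" for x
  proof (cases "x = r")
    case False
    then have "card (hospitals_of (insert (r, h) N) x) \<le> card (hospitals_of M x)"
      using sub[of x] finite_hospitals_of[OF finM]
      by (simp add: hospitals_of_insert card_mono)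
    then show ?thesis
      using match that by (fastforce simp: is_matching_def)
  qed (simp add: hospitals_of_insert hr)
  moreover have "card (residents_of (insert (r, h) N) k) \<le> upper_quota I k"
    if "k \<in> hospitals I" for k
    using that card_h other[of k] match by (cases "k = h") (auto simp: is_matching_def)
  moreover have "insert (r, h) N \<subseteq> residents I \<times> hospitals I"
    using N match r h by (auto simp: is_matching_def)
  ultimately have match': "is_matching I (insert (r, h) N)"
    by (simp add: is_matching_def)
  have "hospitals_of (insert (r, h) N) x = {}"
    if x: "x \<in> residents I" and k: "k \<in> hospitals I" and bl: "blocks I (insert (r, h) N) x k"
    for x k
  proof (rule ccontr)
    assume ne: "hospitals_of (insert (r, h) N) x \<noteq> {}"
    then obtain h' where h': "h' \<in> hospitals_of (insert (r, h) N) x"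
      and pref: "strictly_prefers (res_pref I x) k h'"
      using bl by (auto simp: blocks_def)
    have hosp_side: "card (residents_of (insert (r, h) N) k) < upper_quota I k \<or>
        (\<exists>y\<in>residents_of (insert (r, h) N) k. strictly_prefers (hosp_pref I k) x y)"
      using bl by (simp add: blocks_def)
    show False
    proof (cases "x = r")
      \<comment> \<open>If \<open>r\<close> itself blocked with some \<open>k\<close>, then
        \<open>k\<close> would differ from \<open>h\<close>, would have blocked with
        \<open>r\<close> already in \<open>M\<close>, and would be preferred to \<open>h\<close>,
        against the choice of \<open>h\<close>.\<close>
      case True
      then have "h' = h"
        using h' hr by (simp add: hospitals_of_insert)
      then have "k \<noteq> h"
        using pref by (auto simp: strictly_prefers_def)
      then have "blocks I M r k"
        using hosp_side other r True by (simp add: blocks_def)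
      then show False
        using best[OF k] pref \<open>h' = h\<close> True by simp
    next
      case False
      then have h'M: "h' \<in> hospitals_of M x"
        using h' sub by (auto simp: hospitals_of_insert)
      \<comment> \<open>Resident \<open>x\<close> keeps its hospital from \<open>M\<close>, so it
        suffices that \<open>k\<close> was already willing to take \<open>x\<close> in
        \<open>M\<close>: then a matched resident blocks \<open>M\<close>.\<close>
      have "card (residents_of M k) < upper_quota I k \<or>
        (\<exists>y\<in>residents_of M k. strictly_prefers (hosp_pref I k) x y)"
      proof (cases "k = h")
        case True
        from hosp_side show ?thesis
        proof
          assume "card (residents_of (insert (r, h) N) k) < upper_quota I k"
          then show ?thesis
            using card_h True by simp
        next
          assume "\<exists>y\<in>residents_of (insert (r, h) N) k. strictly_prefers (hosp_pref I k) x y"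
          then obtain y where y: "y \<in> residents_of (insert (r, h) N) k"
            "strictly_prefers (hosp_pref I k) x y" by blast
          show ?thesis
          proof (cases "y = r")
            case True
            \<comment> \<open>Either \<open>h\<close> had a vacancy in \<open>M\<close>, or
              \<open>x\<close> beats \<open>r\<close>, who beats the displaced
              \<open>r'\<close>.\<close>
            then show ?thesis
              using N y(2) strictly_prefers_trans[OF trans_hosp_pref[OF I h]] \<open>k = h\<close>
              by (auto simp: residents_of_def)
          next
            case False
            then have "y \<in> residents_of M k"
              using y(1) N by (auto simp: residents_of_def)
            then show ?thesis
              using y(2) by blast
          qed
        qed
      qed (use hosp_side other in simp)
      then have "blocks I M x k"
        using h'M pref by (auto simp: blocks_def)
      then have "hospitals_of M x = {}"
        using M x k unfolding simple_matching_def by blast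
      then show False
        using h'M by simp
    qed
  qed
  then show ?thesis
    using match' by (simp add: simple_matching_def)
qed

text \<open>Either a positive summand is added, or the summand of \<open>r'\<close> is replaced by
  the larger one of \<open>r\<close>.\<close>

lemma hospital_welfare_satisfy:
  assumes I: "hrt_mslq_instance I" and M: "is_matching I M"
    and r: "hospitals_of M r = {}" and h: "h \<in> hospitals I"
    and N: "N = M \<or>
            N = M - {(r', h)} \<and> (r', h) \<in> M \<and> strictly_prefers (hosp_pref I h) r r'"
  shows "hospital_welfare I M < hospital_welfare I (insert (r, h) N)"
proof -
  have finM: "finite M"
    using finite_matching[OF I M] .
  let ?w = "\<lambda>(r, h). Suc (pref_rank (residents I) (hosp_pref I h) r)"
  have new: "(r, h) \<notin> N" "finite N"
    using N r finM by (auto simp: hospitals_of_def)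
  then have ins: "hospital_welfare I (insert (r, h) N) = ?w (r, h) + hospital_welfare I N"
    by (simp add: hospital_welfare_def)
  from N show ?thesis
  proof
    assume *: "N = M - {(r', h)} \<and> (r', h) \<in> M \<and> strictly_prefers (hosp_pref I h) r r'"
    then have "r' \<in> residents I"
      using M by (auto simp: is_matching_def)
    then have "?w (r', h) < ?w (r, h)"
      using pref_rank_less[OF _ trans_hosp_pref[OF I h]] * I
      by (simp add: hrt_mslq_instance_def)
    moreover have "hospital_welfare I M = ?w (r', h) + hospital_welfare I N"
      unfolding hospital_welfare_def using sum.remove[OF finM, of "(r', h)" ?w] * by simp
    ultimately show ?thesis
      using ins by linarith
  qed (use ins in simp)
qed

text \<open>Needed because \<open>OPT\<close> and \<open>WST\<close> are \<open>Max\<close> and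
  \<open>Min\<close>, about which nothing useful is known on an empty set.\<close>

theorem stable_matching_exists:
  assumes I: "hrt_mslq_instance I"
  shows "\<exists>M. is_stable I M"
proof -
  have fin: "finite (residents I)" "finite (hospitals I)"
    using I by (auto simp: hrt_mslq_instance_def)
  have "simple_matching I {}"
    by (simp add: simple_matching_def is_matching_def hospitals_of_def residents_of_def)
  moreover have "finite {M. simple_matching I M}"
    by (rule finite_subset[of _ "Pow (residents I \<times> hospitals I)"])
      (use fin in \<open>auto simp: simple_matching_def is_matching_def\<close>)
  ultimately obtain M where M: "simple_matching I M"
    and max: "\<And>N. simple_matching I N \<Longrightarrow> hospital_welfare I N \<le> hospital_welfare I M"
    using finite_arg_max[of "{M. simple_matching I M}" "hospital_welfare I"] by auto
  have match: "is_matching I M"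
    using M by (simp add: simple_matching_def)
  have "\<not> blocks I M r h0" if r: "r \<in> residents I" and h0: "h0 \<in> hospitals I" for r h0
  proof
    assume bl0: "blocks I M r h0"
    then have unmatched: "hospitals_of M r = {}"
      using M r h0 unfolding simple_matching_def by blast
    \<comment> \<open>Choosing a blocking hospital of maximal rank for \<open>r\<close> yields the
      premise \<open>best\<close> of the improvement step.\<close>
    let ?B = "{h \<in> hospitals I. blocks I M r h}"
    have "finite ?B" "?B \<noteq> {}"
      using fin bl0 h0 by auto
    then obtain h where "h \<in> ?B" and
      rank: "\<And>k. k \<in> ?B \<Longrightarrow> pref_rank (hospitals I) (res_pref I r) k
                     \<le> pref_rank (hospitals I) (res_pref I r) h"
      using finite_arg_max[of ?B "pref_rank (hospitals I) (res_pref I r)"] by meson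
    then have h: "h \<in> hospitals I" and bl: "blocks I M r h"
      by auto
    have best: "\<not> strictly_prefers (res_pref I r) k h"
      if "k \<in> hospitals I" "blocks I M r k" for k
      using rank[of k] that pref_rank_less[OF fin(2) trans_res_pref[OF I r] h, of k] by force
    \<comment> \<open>In the vacancy case \<open>r'\<close> is arbitrary.\<close>
    obtain r' N where N: "N = M \<and> card (residents_of M h) < upper_quota I h \<or>
        N = M - {(r', h)} \<and> (r', h) \<in> M \<and> strictly_prefers (hosp_pref I h) r r'"
      using bl by (auto simp: blocks_def residents_of_def)
    then have "hospital_welfare I M < hospital_welfare I (insert (r, h) N)"
      using hospital_welfare_satisfy[OF I match unmatched h, of N r'] by blast
    moreover have "simple_matching I (insert (r, h) N)"
      using simple_matching_satisfy[OF I M r unmatched h best N] .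
    ultimately show False
      using max[of "insert (r, h) N"] by simp
  qed
  then show ?thesis
    using match by (auto simp: is_stable_def)
qed

section \<open>Double counting and score bounds\<close>

lemma sum_card_hospitals_of:
  assumes "hrt_mslq_instance I" "is_matching I M"
  shows "(\<Sum>r\<in>residents I. card (hospitals_of M r)) = card M"
proof -
  have "M = Sigma (residents I) (hospitals_of M)"
    using assms(2) by (auto simp: is_matching_def hospitals_of_def)
  moreover have "card (Sigma (residents I) (hospitals_of M)) =
      (\<Sum>r\<in>residents I. card (hospitals_of M r))"
    using assms finite_hospitals_of[OF finite_matching[OF assms]]
    by (simp add: hrt_mslq_instance_def)
  ultimately show ?thesis
    by simp
qed

lemma sum_card_residents_of:
  assumes "hrt_mslq_instance I" "is_matching I M"
  shows "(\<Sum>h\<in>hospitals I. card (residents_of M h)) = card M"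
proof -
  have "M\<inverse> = Sigma (hospitals I) (residents_of M)"
    using assms(2) by (auto simp: is_matching_def residents_of_def)
  moreover have "card (Sigma (hospitals I) (residents_of M)) =
      (\<Sum>h\<in>hospitals I. card (residents_of M h))"
    using assms finite_residents_of[OF finite_matching[OF assms]]
    by (simp add: hrt_mslq_instance_def)
  ultimately show ?thesis
    by (metis card_inverse)
qed

text \<open>A matching has at most as many pairs as there are residents, so some hospital has a
  vacancy; any unmatched resident would block with it.\<close>

lemma stable_card:
  assumes I: "hrt_mslq_instance I" and M: "is_stable I M"
  shows "card M = card (residents I)"
proof -
  have match: "is_matching I M"
    using M by (simp add: is_stable_def)
  have le1: "card (hospitals_of M r) \<le> 1" if "r \<in> residents I" for r
    using match that by (simp add: is_matching_def)
  have "card M \<le> card (residents I)"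
    using sum_mono[of "residents I" "\<lambda>r. card (hospitals_of M r)" "\<lambda>_. 1"] le1
    by (simp add: sum_card_hospitals_of[OF I match])
  then have "(\<Sum>h\<in>hospitals I. card (residents_of M h)) < (\<Sum>h\<in>hospitals I. upper_quota I h)"
    using I by (simp add: sum_card_residents_of[OF I match] hrt_mslq_instance_def)
  then obtain h where h: "h \<in> hospitals I" "card (residents_of M h) < upper_quota I h"
    by (meson leD leI sum_mono)
  have "card (hospitals_of M r) = 1" if r: "r \<in> residents I" for r
  proof -
    have "hospitals_of M r \<noteq> {}"
      using M h r by (auto simp: is_stable_def blocks_def)
    then have "0 < card (hospitals_of M r)"
      using finite_hospitals_of[OF finite_matching[OF I match]] by (simp add: card_gt_0_iff)
    then show ?thesis
      using le1[OF r] by simp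
  qed
  then show ?thesis
    using sum_card_hospitals_of[OF I match] by simp
qed

lemma finite_stable:
  assumes "hrt_mslq_instance I"
  shows "finite {M. is_stable I M}"
  by (rule finite_subset[of _ "Pow (residents I \<times> hospitals I)"])
    (use assms in \<open>auto simp: is_stable_def is_matching_def hrt_mslq_instance_def\<close>)

lemma stable_score_bounds:
  assumes I: "hrt_mslq_instance I" and q: "uniform_quotas l u I" and l: "1 \<le> l" "l \<le> u"
    and M: "is_stable I M"
  shows "real (card (residents I)) / real u \<le> score I M"
    and "score I M \<le> real (card (residents I)) / real l"
proof -
  have match: "is_matching I M"
    using M by (simp add: is_stable_def)
  have sc: "hospital_score I M h = min 1 (real (card (residents_of M h)) / real l)"
    and cd: "card (residents_of M h) \<le> u"
    if "h \<in> hospitals I" for h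
    using that q l match by (simp_all add: hospital_score_def uniform_quotas_def is_matching_def)
  \<comment> \<open>The denominator stays general because both \<open>u\<close> and \<open>l\<close>
    are used below.\<close>
  have total: "(\<Sum>h\<in>hospitals I. real (card (residents_of M h)) / c) =
      real (card (residents I)) / c" for c
    using sum_card_residents_of[OF I match] stable_card[OF I M]
    by (simp flip: sum_divide_distrib of_nat_sum)
  \<comment> \<open>The left side is at most 1 by the upper quota, and at most the quotient by
    \<open>l\<close> since \<open>l \<le> u\<close>; hence it is below both arguments of
    \<open>min\<close>.\<close>
  have "real (card (residents_of M h)) / real u \<le> hospital_score I M h"
    if "h \<in> hospitals I" for h
    using sc[OF that] cd[OF that] l by (simp add: frac_le)
  then show "real (card (residents I)) / real u \<le> score I M"
    unfolding score_def total[symmetric] by (rule sum_mono)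
  have "hospital_score I M h \<le> real (card (residents_of M h)) / real l"
    if "h \<in> hospitals I" for h
    using sc[OF that] by simp
  then show "score I M \<le> real (card (residents I)) / real l"
    unfolding score_def total[symmetric] by (rule sum_mono)
qed

lemma OPT_WST_bounds:
  assumes I: "hrt_mslq_instance I" and q: "uniform_quotas l u I" and l: "1 \<le> l" "l \<le> u"
  shows "real (card (residents I)) / real u \<le> WST I"
    and "OPT I \<le> real (card (residents I)) / real l"
proof -
  have fin: "finite (score I ` {M. is_stable I M})"
    using finite_stable[OF I] by simp
  have ne: "score I ` {M. is_stable I M} \<noteq> {}"
    using stable_matching_exists[OF I] by simp
  show "real (card (residents I)) / real u \<le> WST I"
    unfolding WST_def using stable_score_bounds(1)[OF I q l] fin ne by simp
  show "OPT I \<le> real (card (residents I)) / real l"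
    unfolding OPT_def using stable_score_bounds(2)[OF I q l] fin ne by simp
qed

lemma OPT_WST_ratio_le:
  assumes I: "hrt_mslq_instance I" and q: "uniform_quotas l u I" and l: "1 \<le> l" "l \<le> u"
  shows "OPT I / WST I \<le> real u / real l"
proof -
  let ?n = "real (card (residents I))"
  have n: "?n > 0"
    using I by (simp add: hrt_mslq_instance_def card_gt_0_iff)
  \<comment> \<open>A positive lower bound on \<open>WST I\<close> permits dividing the two bounds,
    after which \<open>?n\<close> cancels.\<close>
  then have pos: "0 < ?n / real u"
    using l by simp
  then have "OPT I / WST I \<le> (?n / real l) / (?n / real u)"
    by (intro frac_le OPT_WST_bounds[OF I q l]) simp_all
  also have "\<dots> = real u / real l"
    using n by simp
  finally show ?thesis .
qed

section \<open>An instance attaining the ratio\<close>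

text \<open>Only the residents have ties: all hospitals rank the residents by index, so the same
  instance serves the restricted maximum.\<close>

definition indifferent_instance :: "nat \<Rightarrow> nat \<Rightarrow> (nat, nat) hrt_mslq" where
  "indifferent_instance l u =
     \<lparr>residents = {..<l * u}, hospitals = {..u},
      res_pref = (\<lambda>_. {..u} \<times> {..u}),
      hosp_pref = (\<lambda>_. {(x, y). x \<le> y \<and> y < l * u}),
      lower_quota = (\<lambda>_. l), upper_quota = (\<lambda>_. u)\<rparr>"

text \<open>
  The last hospital \<open>u\<close> stays empty; it keeps the total capacity above \<open>l * u\<close> even if \<open>l = u\<close>.
\<close>

lemma indifferent_instance:
  assumes "1 \<le> l" "l \<le> u"
  shows "hrt_mslq_instance (indifferent_instance l u)"
    and "uniform_quotas l u (indifferent_instance l u)"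
    and "hospitals_no_ties (indifferent_instance l u)"
proof -
  \<comment> \<open>The right side is the total capacity of the \<open>u + 1\<close>
    hospitals.\<close>
  have "l * u < u + u * u"
    using assms mult_le_mono1[of l u u] by linarith
  moreover have "{..<l * u} \<noteq> {}"
    using assms by (simp add: lessThan_empty_iff)
  ultimately show "hrt_mslq_instance (indifferent_instance l u)"
    using assms
    by (auto simp: hrt_mslq_instance_def indifferent_instance_def total_preorder_on_def
        preorder_on_def refl_on_def trans_def total_on_def)
qed (auto simp: uniform_quotas_def hospitals_no_ties_def indifferent_instance_def antisym_def)

text \<open>Dealing out \<open>c * d\<close> residents cyclically gives exactly \<open>c\<close> to
  each of the first \<open>d\<close> hospitals. The choices \<open>d = u\<close> and
  \<open>d = l\<close> produce the best and the worst stable matching.\<close>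

definition mod_matching :: "nat \<Rightarrow> nat \<Rightarrow> (nat \<times> nat) set" where
  "mod_matching n d = {(r, r mod d) | r. r < n}"

lemma card_mod_class:
  fixes c d h :: nat
  assumes "h < d"
  shows "card {r. r < c * d \<and> r mod d = h} = c"
proof -
  have "bij_betw (\<lambda>q. q * d + h) {..<c} {r. r < c * d \<and> r mod d = h}"
  proof (rule bij_betw_byWitness[where f' = "\<lambda>r. r div d"])
    show "(\<lambda>q. q * d + h) ` {..<c} \<subseteq> {r. r < c * d \<and> r mod d = h}"
    proof clarify
      fix q assume "q < c"
      then have "(q + 1) * d \<le> c * d"
        by (intro mult_le_mono1) simp
      then show "q * d + h < c * d \<and> (q * d + h) mod d = h"
        using assms by simp
    qed
    show "(\<lambda>r. r div d) ` {r. r < c * d \<and> r mod d = h} \<subseteq> {..<c}"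
      by (auto simp: less_mult_imp_div_less)
  qed (use assms in auto)
  from bij_betw_same_card[OF this] show ?thesis
    by simp
qed

lemma card_residents_of_mod_matching:
  assumes "1 \<le> d"
  shows "card (residents_of (mod_matching (c * d) d) h) = (if h < d then c else 0)"
proof (cases "h < d")
  case True
  have "residents_of (mod_matching (c * d) d) h = {r. r < c * d \<and> r mod d = h}"
    by (auto simp: residents_of_def mod_matching_def)
  then show ?thesis
    using card_mod_class[OF True] True by simp
next
  case False
  have "r mod d < d" for r
    using assms by simp
  then have "residents_of (mod_matching (c * d) d) h = {}"
    using False by (auto simp: residents_of_def mod_matching_def)
  then show ?thesis
    using False by simp
qed

text \<open>Every resident is matched and indifferent, so the resident's half of
  \<open>blocks\<close> always fails. What remains is feasibility: \<open>c \<le> u\<close> respects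
  the quota and \<open>d \<le> u\<close> keeps the hospitals in range.\<close>

lemma mod_matching_stable:
  assumes "1 \<le> d" "d \<le> u" "c \<le> u" "c * d = l * u"
  shows "is_stable (indifferent_instance l u) (mod_matching (c * d) d)"
proof -
  have hosp: "hospitals_of (mod_matching (c * d) d) r = {r mod d}" if "r < c * d" for r
    using that by (auto simp: hospitals_of_def mod_matching_def)
  have modle: "r mod d \<le> u" for r
    using assms mod_less_divisor[of d r] by linarith
  have "is_matching (indifferent_instance l u) (mod_matching (c * d) d)"
    using hosp modle assms card_residents_of_mod_matching[OF assms(1), of c]
    by (auto simp: is_matching_def indifferent_instance_def mod_matching_def)
  moreover have "\<not> blocks (indifferent_instance l u) (mod_matching (c * d) d) r h"
    if "r < c * d" "h \<le> u" for r h
    using that hosp[OF that(1)] modle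
    by (simp add: blocks_def indifferent_instance_def strictly_prefers_def)
  ultimately show ?thesis
    using assms by (simp add: is_stable_def indifferent_instance_def)
qed

text \<open>The first \<open>d\<close> hospitals meet their lower quota and score 1; the others are
  empty and score 0.\<close>

lemma score_mod_matching:
  assumes "1 \<le> d" "d \<le> u" "1 \<le> l" "l \<le> c"
  shows "score (indifferent_instance l u) (mod_matching (c * d) d) = real d"
proof -
  have "score (indifferent_instance l u) (mod_matching (c * d) d) =
      (\<Sum>h\<le>u. if h < d then 1 else 0)"
    unfolding score_def hospital_score_def
    using assms card_residents_of_mod_matching[OF assms(1), of c]
    by (intro sum.cong) (auto simp: indifferent_instance_def)
  also have "\<dots> = real (card ({..u} \<inter> {h. h < d}))"
    by (simp add: sum.If_cases)
  also have "{..u} \<inter> {h. h < d} = {..<d}"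
    using assms by auto
  finally show ?thesis
    by simp
qed

lemma OPT_WST_indifferent_instance:
  assumes "1 \<le> l" "l \<le> u"
  shows "OPT (indifferent_instance l u) / WST (indifferent_instance l u) = real u / real l"
proof -
  let ?I = "indifferent_instance l u"
  let ?S = "score ?I ` {M. is_stable ?I M}"
  note I = indifferent_instance(1,2)[OF assms]
  have card: "card (residents ?I) = l * u"
    by (simp add: indifferent_instance_def)
  have fin: "finite ?S"
    using finite_stable[OF I(1)] by simp
  have "real u \<in> ?S"
    using mod_matching_stable[of u u l l] score_mod_matching[of u u l l] assms
    by (auto intro: rev_image_eqI)
  then have "real u \<le> OPT ?I"
    unfolding OPT_def using fin by simp
  moreover have "real l \<in> ?S"
    using mod_matching_stable[of l u u l] score_mod_matching[of l u l u] assms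
    by (auto simp: mult.commute intro: rev_image_eqI)
  then have "WST ?I \<le> real l"
    unfolding WST_def using fin by simp
  \<comment> \<open>With \<open>l * u\<close> residents the general bounds become
    \<open>OPT ?I \<le> u\<close> and \<open>l \<le> WST ?I\<close>, the converse
    inequalities.\<close>
  ultimately have "OPT ?I = real u" "WST ?I = real l"
    using OPT_WST_bounds[OF I assms] assms card by simp_all
  then show ?thesis
    by simp
qed

theorem proposition8:
  fixes l u :: nat and \<theta> :: real
  assumes "1 \<le> l" and "l \<le> u" and "\<theta> = real u / real l"
  shows "is_maximum_of \<theta>
           {OPT I / WST I | I :: (nat, nat) hrt_mslq.
              hrt_mslq_instance I \<and> uniform_quotas l u I} \<and>
         is_maximum_of \<theta>
           {OPT I / WST I | I :: (nat, nat) hrt_mslq.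
              hrt_mslq_instance I \<and> uniform_quotas l u I \<and> hospitals_no_ties I}"
proof -
  \<comment> \<open>This instance lies in both classes, and the upper bound for the larger class
    covers the smaller one.\<close>
  have "\<theta> = OPT (indifferent_instance l u) / WST (indifferent_instance l u)"
    using OPT_WST_indifferent_instance[OF assms(1,2)] assms(3) by simp
  moreover have "OPT I / WST I \<le> \<theta>"
    if "hrt_mslq_instance I" "uniform_quotas l u I" for I :: "(nat, nat) hrt_mslq"
    using OPT_WST_ratio_le[OF that assms(1,2)] assms(3) by simp
  ultimately show ?thesis
    unfolding is_maximum_of_def using indifferent_instance[OF assms(1,2)] by blast
qed

end
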